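(* For every integer $n\ge 5$ there exists a regular $3$-polytope of order $3\cdot 2^n$ with Schläfli type $\{6,6\}$.
   Context: A string C-group of rank $3$ is a pair $(G,\{\rho_0,\rho_1,\rho_2\})$ where $G$ is a group generated by the ordered set of involutions $\rho_0,\rho_1,\rho_2$ such that $\rho_0\rho_2=\rho_2\rho_0$ (string property) and, writing $G_I=\langle \rho_i : i\in I\rangle$, one has $G_I\cap G_J=G_{I\cap J}$ for all $I,J\subseteq\{0,1,2\}$ (intersection property). Its order is $|G|$ and its (Schläfli) type is $\{o(\rho_0\rho_1),o(\rho_1\rho_2)\}$, an ordered pair. Abstract regular $3$-polytopes and string C-groups of rank $3$ are the same objects: the automorphism group of a regular $3$-polytope $\mathcal P$, with the distinguished generators attached to a flag, is a string C-group of rank $3$, and conversely every string C-group of rank $3$ is the automorphism group of a regular $3$-polytope; the order and type of $\mathcal P$ are those of the string C-group. *)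

theory Defs
  imports "HOL-Algebra.Algebra"
begin

text \<open>
  Abstract regular 3-polytopes are identified with string C-groups of rank 3: the automorphism
  group of a regular 3-polytope together with the distinguished generators attached to a base
  flag. The order and the Schlaefli type of the polytope are those of the string C-group.
  Only \<open>\<rho> 0\<close>, \<open>\<rho> 1\<close> and \<open>\<rho> 2\<close> are relevant; other values of \<open>\<rho>\<close> are ignored.
\<close>

locale string_C_group3 = group G for G (structure) +
  fixes \<rho> :: "nat \<Rightarrow> 'a"
  assumes rho_closed: "i \<in> {0, 1, 2} \<Longrightarrow> \<rho> i \<in> carrier G"
    and rho_involution: "i \<in> {0, 1, 2} \<Longrightarrow> ord (\<rho> i) = 2"
    and rho_generate: "generate G (\<rho> ` {0, 1, 2}) = carrier G"
    and string_property: "\<rho> 0 \<otimes> \<rho> 2 = \<rho> 2 \<otimes> \<rho> 0"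
    and intersection_property:
      "I \<subseteq> {0, 1, 2} \<Longrightarrow> J \<subseteq> {0, 1, 2} \<Longrightarrow>
        generate G (\<rho> ` I) \<inter> generate G (\<rho> ` J) = generate G (\<rho> ` (I \<inter> J))"

definition schlafli_type :: "('a, 'b) monoid_scheme \<Rightarrow> (nat \<Rightarrow> 'a) \<Rightarrow> nat \<times> nat" where
  "schlafli_type G \<rho> =
    (group.ord G (\<rho> 0 \<otimes>\<^bsub>G\<^esub> \<rho> 1), group.ord G (\<rho> 1 \<otimes>\<^bsub>G\<^esub> \<rho> 2))"

end

theory Submission
  imports Defs
begin

text \<open>
  The automorphism group of the Petrie-Coxeter polyhedron \<open>{6,6|3}\<close> is the crystallographic group
  \<open>\<Gamma>\<close> generated by the half-turn \<open>(x,y,z) \<mapsto> (y+1, x-1, 1-z)\<close>, the reflection \<open>(x,y,z) \<mapsto> (x,z,y)\<close> and the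
  half-turn \<open>(x,y,z) \<mapsto> (1-y, 1-x, 1-z)\<close>. Its point group consists of all 48 signed permutations and
  its translation lattice is \<open>2\<int>\<^sup>3\<close>. If \<open>L\<close> is a sublattice of \<open>\<int>\<^sup>3\<close> invariant under signed
  permutations, then \<open>\<Gamma>/2L\<close> has order \<open>48 [\<int>\<^sup>3 : L]\<close>. The first two generators fix
  \<open>(3/2, 1/2, 1/2)\<close>, the last two fix \<open>(1/2, 1/2, 1/2)\<close>; comparing translation parts shows that the
  intersection property survives in the quotient as soon as \<open>(1,0,0) \<notin> L\<close>. Primitive, face-centred
  and body-centred cubic lattices scaled by powers of 2 realise every index \<open>2\<^sup>e\<close> with \<open>e \<ge> 1\<close>.
\<close>

section \<open>A criterion for string C-groups of rank 3\<close>

lemma (in group) generate_involution: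
  assumes "a \<in> carrier G" "a \<otimes> a = \<one>"
  shows "generate G {a} = {\<one>, a}"
proof (rule generateI[symmetric])
  show "subgroup {\<one>, a} G"
    using assms inv_equality[OF assms(2)] by (intro subgroupI) auto
  show "{\<one>, a} \<subseteq> K" if "subgroup K G" "{a} \<subseteq> K" for K
    using that subgroup.one_closed by auto
qed auto

lemma (in group) generate_commuting_involutions:
  assumes [simp]: "a \<in> carrier G" "b \<in> carrier G"
    and "a \<otimes> a = \<one>" "b \<otimes> b = \<one>" "a \<otimes> b = b \<otimes> a"
  shows "generate G {a, b} = {\<one>, a, b, a \<otimes> b}"
proof (rule generateI[symmetric])
  have ab: "b \<otimes> a = a \<otimes> b" using assms by simp
  have aab: "a \<otimes> (a \<otimes> c) = c" if "c \<in> carrier G" for c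
    using that assms by (simp flip: m_assoc)
  have bab: "b \<otimes> (a \<otimes> b) = a"
    using assms by (metis ab m_assoc r_one)
  have eqs: "a \<otimes> (a \<otimes> b) = b" "b \<otimes> (a \<otimes> b) = a" "(a \<otimes> b) \<otimes> a = b" "(a \<otimes> b) \<otimes> b = a"
    "(a \<otimes> b) \<otimes> (a \<otimes> b) = \<one>"
    using assms aab[of b] bab by (simp_all add: m_assoc ab)
  have invs: "inv a = a" "inv b = b" "inv (a \<otimes> b) = a \<otimes> b"
    using assms eqs by (auto intro!: inv_equality)
  show "subgroup {\<one>, a, b, a \<otimes> b} G"
    using assms(3,4) eqs ab invs by (intro subgroupI) auto
  show "{\<one>, a, b, a \<otimes> b} \<subseteq> K" if "subgroup K G" "{a, b} \<subseteq> K" for K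
    using that subgroup.one_closed subgroup.m_closed by fastforce
qed auto

lemma (in group) ord_eqI_6:
  assumes "x \<in> carrier G" "x [^] (6::nat) = \<one>" "x [^] (2::nat) \<noteq> \<one>" "x [^] (3::nat) \<noteq> \<one>"
  shows "ord x = 6"
proof -
  have "ord x dvd 6" "\<not> ord x dvd 2" "\<not> ord x dvd 3"
    using assms pow_eq_id by auto
  moreover from this(1) have "ord x \<in> {1, 2, 3, 6}"
  proof -
    have "ord x \<le> 6" using \<open>ord x dvd 6\<close> by (auto dest: dvd_imp_le)
    then have "ord x \<in> {0, 1, 2, 3, 4, 5, 6}" by auto
    then show ?thesis using \<open>ord x dvd 6\<close> by auto
  qed
  ultimately show ?thesis by auto
qed

text \<open>In rank 3 the intersection property reduces to the pair of dihedral subgroups. Nested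
  index sets are handled by monotonicity, and the remaining pairs involve only the small subgroups
  listed in \<open>D\<close> and membership facts drawn from \<open>inter\<close>.\<close>

lemma (in group) string_C_group3I:
  assumes closed: "\<rho> 0 \<in> carrier G" "\<rho> 1 \<in> carrier G" "\<rho> 2 \<in> carrier G"
    and sq: "\<rho> 0 \<otimes> \<rho> 0 = \<one>" "\<rho> 1 \<otimes> \<rho> 1 = \<one>" "\<rho> 2 \<otimes> \<rho> 2 = \<one>"
    and ne: "\<rho> 0 \<noteq> \<one>" "\<rho> 1 \<noteq> \<one>" "\<rho> 2 \<noteq> \<one>" "\<rho> 0 \<noteq> \<rho> 1" "\<rho> 2 \<noteq> \<rho> 1"
    and gen: "generate G {\<rho> 0, \<rho> 1, \<rho> 2} = carrier G"
    and comm: "\<rho> 0 \<otimes> \<rho> 2 = \<rho> 2 \<otimes> \<rho> 0"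
    and inter: "generate G {\<rho> 0, \<rho> 1} \<inter> generate G {\<rho> 1, \<rho> 2} \<subseteq> {\<one>, \<rho> 1}"
  shows "string_C_group3 G \<rho>"
proof
  define a b c where abc: "a = \<rho> 0" "b = \<rho> 1" "c = \<rho> 2"
  note A = assms[folded abc]
  let ?D = "generate G"
  have incl: "x \<in> ?D S" if "x \<in> S" for x S
    using that generate.incl by metis
  have m: "x \<otimes> y \<in> ?D S" if "x \<in> ?D S" "y \<in> ?D S" for x y S
    using that generate.eng by metis
  have one: "\<one> \<in> ?D S" for S
    by (rule generate.one)
  have D: "?D {} = {\<one>}" "?D {a} = {\<one>, a}" "?D {b} = {\<one>, b}" "?D {c} = {\<one>, c}"
    "?D {a, c} = {\<one>, a, c, a \<otimes> c}"
    using generate_empty A(1-6) generate_involution generate_commuting_involutions A(13) by auto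
  \<comment> \<open>If \<open>a\<close> lay in \<open>?D {b, c}\<close>, it would lie in both
    dihedral subgroups and hence be \<open>\<one>\<close> or \<open>b\<close>; the same holds for
    \<open>c\<close> in \<open>?D {a, b}\<close>.\<close>
  have a12: "a \<notin> ?D {b, c}" and c01: "c \<notin> ?D {a, b}"
    using A(7-11,14) incl[of a "{a, b}"] incl[of c "{b, c}"] by auto
  have aac: "a \<otimes> (a \<otimes> c) = c" and acc: "(a \<otimes> c) \<otimes> c = a"
    using A(1-6) by (simp flip: m_assoc, simp add: m_assoc)
  have ac: "a \<otimes> c \<notin> ?D {a, b}" "a \<otimes> c \<notin> ?D {b, c}"
    using c01 a12 m[of a "{a, b}" "a \<otimes> c"] m[of "a \<otimes> c" "{b, c}" c]
      incl[of a "{a, b}"] incl[of c "{b, c}"] aac acc by auto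
  have acb: "a \<noteq> c" "a \<noteq> b" "c \<noteq> b" "a \<otimes> c \<noteq> b"
    using a12 A(10,11) ac incl[of a "{b,c}"] incl[of c "{b, c}"] incl[of b "{b, c}"] by auto
  show "\<rho> i \<in> carrier G" if "i \<in> {0, 1, 2}" for i
    using that closed by auto
  show "ord (\<rho> i) = 2" if "i \<in> {0, 1, 2}" for i
  proof -
    have "x \<in> carrier G \<Longrightarrow> x \<otimes> x = \<one> \<Longrightarrow> x \<noteq> \<one> \<Longrightarrow> ord x = 2" for x
    proof -
      assume x: "x \<in> carrier G" "x \<otimes> x = \<one>" "x \<noteq> \<one>"
      then have "x [^] (2::nat) = \<one>"
        by (simp add: numeral_2_eq_2)
      then have "ord x dvd 2"
        using x(1) pow_eq_id by auto
      moreover have "ord x \<noteq> 1"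
        using x ord_eq_1 by auto
      ultimately show "ord x = 2"
        by (metis prime_nat_iff two_is_prime_nat)
    qed
    then show ?thesis
      using that closed sq ne by auto
  qed
  show "generate G (\<rho> ` {0, 1, 2}) = carrier G"
    using gen by simp
  show "\<rho> 0 \<otimes> \<rho> 2 = \<rho> 2 \<otimes> \<rho> 0"
    by (rule comm)
  let ?P = "\<lambda>I J. ?D (\<rho> ` I) \<inter> ?D (\<rho> ` J) = ?D (\<rho> ` (I \<inter> J))"
  have sub: "?P I J \<and> ?P J I" if "I \<subseteq> J" for I J
  proof -
    have "?D (\<rho> ` I) \<subseteq> ?D (\<rho> ` J)" "I \<inter> J = I"
      using mono_generate[OF image_mono[OF that]] that by auto
    then show ?thesis
      by (auto simp: Int_commute)
  qed
  have sym: "?P I J \<Longrightarrow> ?P J I" for I J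
    by (simp add: Int_commute)
  have "?P {0} {1}" "?P {0} {2}" "?P {1} {2}" "?P {1} {0, 2}"
    using D acb A(7-9) by (auto simp flip: abc simp del: One_nat_def)
  moreover have "?P {0} {1, 2}" "?P {2} {0, 1}"
    using D a12 c01 one by (auto simp flip: abc simp del: One_nat_def)
  moreover have "?P {0, 2} {0, 1}" "?P {0, 2} {1, 2}"
    using D a12 c01 ac one incl[of a "{a, b}"] incl[of c "{b, c}"]
    by (auto simp flip: abc simp del: One_nat_def)
  moreover have "?P {0, 1} {1, 2}"
    using D A(14) one incl[of b "{a, b}"] incl[of b "{b, c}"]
    by (auto simp flip: abc simp del: One_nat_def)
  ultimately have base: "?P {0} {1}" "?P {0} {2}" "?P {1} {2}" "?P {1} {0, 2}"
    "?P {0} {1, 2}" "?P {2} {0, 1}" "?P {0, 2} {0, 1}" "?P {0, 2} {1, 2}" "?P {0, 1} {1, 2}"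
    by blast+
  \<comment> \<open>Up to order these are all nine pairs of incomparable subsets of
    \<open>{0, 1, 2}\<close>.\<close>
  define S :: "(nat set \<times> nat set) set" where
    "S = {({0}, {1}), ({0}, {2}), ({1}, {2}), ({1}, {0, 2}), ({0}, {1, 2}), ({2}, {0, 1}),
      ({0, 2}, {0, 1}), ({0, 2}, {1, 2}), ({0, 1}, {1, 2})}"
  have inS: "?P I J" if "(I, J) \<in> S" for I J
    using that unfolding S_def
    by (elim insertE emptyE Pair_inject) (simp_all only: base)
  have K: "K \<in> {{}, {0}, {1}, {2}, {0, 1}, {0, 2}, {1, 2}, {0, 1, 2}}"
    if "K \<subseteq> {0, 1, 2}" for K :: "nat set"
    using that unfolding Pow_iff[symmetric] Pow_insert by auto
  show "?P I J" if I: "I \<subseteq> {0, 1, 2}" and J: "J \<subseteq> {0, 1, 2}" for I J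
  proof -
    have "I \<subseteq> J \<or> J \<subseteq> I \<or> (I, J) \<in> S \<or> (J, I) \<in> S"
      using K[OF I] K[OF J] unfolding S_def
      by (elim insertE emptyE) (simp_all del: One_nat_def)
    then show ?thesis
      using sub[of I J] sub[of J I] inS[of I J] inS[of J I] sym[of J I] by argo
  qed
qed

section \<open>The crystallographic group\<close>

datatype axis = Ax | Ay | Az

lemma UNIV_axis: "UNIV = {Ax, Ay, Az}"
  using axis.exhaust by auto

instance axis :: finite
  by standard (simp add: UNIV_axis)

lemma card_UNIV_axis [simp]: "card (UNIV :: axis set) = 3"
  by (simp add: UNIV_axis)

lemma all_axis: "(\<forall>i. P i) \<longleftrightarrow> P Ax \<and> P Ay \<and> P Az"
  by (metis axis.exhaust)

lemma prod_axis: "prod f UNIV = f Ax * f Ay * f Az" for f :: "axis \<Rightarrow> int"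
  by (simp add: UNIV_axis)

lemma fun_eq_axis: "f = g \<longleftrightarrow> f Ax = g Ax \<and> f Ay = g Ay \<and> f Az = g Az"
  by (simp add: fun_eq_iff all_axis)

type_synonym vec = "axis \<Rightarrow> int"

abbreviation vec3 :: "'a \<Rightarrow> 'a \<Rightarrow> 'a \<Rightarrow> axis \<Rightarrow> 'a" where
  "vec3 \<equiv> case_axis"

definition is_sign :: "vec \<Rightarrow> bool" where
  "is_sign s \<longleftrightarrow> (\<forall>i. s i = 1 \<or> s i = -1)"

text \<open>
  The triple \<open>(p, s, v)\<close> stands for the isometry \<open>x \<mapsto> (\<lambda>i. s i * x (p i) + v i)\<close>
  of the integer lattice; multiplication is composition. The linear parts with an even number of
  signs are the symmetries of a regular tetrahedron.
\<close>

definition crystal :: "((axis \<Rightarrow> axis) \<times> vec \<times> vec) monoid" where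
  "crystal = \<lparr>
    carrier = {(p, s, v). bij p \<and> is_sign s \<and> (\<forall>i. even (v i) \<longleftrightarrow> prod s UNIV = 1)},
    monoid.mult = (\<lambda>(p, s, v) (q, t, w). (q \<circ> p, \<lambda>i. s i * t (p i), \<lambda>i. s i * w (p i) + v i)),
    monoid.one = (id, \<lambda>_. 1, \<lambda>_. 0)\<rparr>"

lemma crystal_carrier:
  "(p, s, v) \<in> carrier crystal \<longleftrightarrow>
    bij p \<and> is_sign s \<and> (\<forall>i. even (v i) \<longleftrightarrow> prod s UNIV = 1)"
  by (simp add: crystal_def)

lemma crystal_mult:
  "(p, s, v) \<otimes>\<^bsub>crystal\<^esub> (q, t, w) = (q \<circ> p, \<lambda>i. s i * t (p i), \<lambda>i. s i * w (p i) + v i)"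
  by (simp add: crystal_def)

lemma crystal_one: "\<one>\<^bsub>crystal\<^esub> = (id, \<lambda>_. 1, \<lambda>_. 0)"
  by (simp add: crystal_def)

lemma is_sign_prod: "is_sign s \<Longrightarrow> prod s UNIV = 1 \<or> prod s UNIV = -1"
  unfolding is_sign_def by (auto simp: prod_axis all_axis)

lemma is_sign_odd: "is_sign s \<Longrightarrow> odd (s i)"
  unfolding is_sign_def by (metis even_minus odd_one)

lemma is_sign_square: "is_sign s \<Longrightarrow> s i * s i = 1"
  unfolding is_sign_def by (metis mult_1 mult_minus1 minus_minus)

lemma prod_sign_comp:
  assumes "bij p"
  shows "(\<Prod>i\<in>UNIV. s i * t (p i)) = prod s UNIV * prod (t :: vec) UNIV"
proof -
  have "(\<Prod>i\<in>UNIV. t (p i)) = prod t UNIV"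
    using assms by (simp add: prod.reindex_bij_betw)
  then show ?thesis by (simp add: prod.distrib)
qed

lemma group_crystal: "group crystal"
proof (rule groupI)
  fix x y assume "x \<in> carrier crystal" "y \<in> carrier crystal"
  then obtain p s v q t w where xy: "x = (p, s, v)" "y = (q, t, w)"
    and p: "bij p" "is_sign s" "\<And>i. even (v i) \<longleftrightarrow> prod s UNIV = 1"
    and q: "bij q" "is_sign t" "\<And>i. even (w i) \<longleftrightarrow> prod t UNIV = 1"
    by (metis crystal_carrier prod_cases3)
  have "is_sign (\<lambda>i. s i * t (p i))"
    using p(2) q(2) unfolding is_sign_def
    by (metis mult_1 mult_minus1 minus_minus)
  \<comment> \<open>Signs are odd, so they do not affect parity. The parity of the translation part
    is therefore additive, matching the multiplicative sign product.\<close>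
  moreover have "even (s i * w (p i) + v i) \<longleftrightarrow> prod s UNIV * prod t UNIV = 1" for i
    using p(3) q(3) is_sign_odd[OF p(2)] is_sign_prod[OF p(2)] is_sign_prod[OF q(2)]
    by auto
  ultimately show "x \<otimes>\<^bsub>crystal\<^esub> y \<in> carrier crystal"
    unfolding xy crystal_mult crystal_carrier prod_sign_comp[OF p(1)]
    using p(1) q(1) by (auto intro: bij_comp)
next
  show "\<one>\<^bsub>crystal\<^esub> \<in> carrier crystal"
    by (simp add: crystal_one crystal_carrier is_sign_def)
next
  fix x y z :: "(axis \<Rightarrow> axis) \<times> vec \<times> vec"
  obtain p s v q t w r u z' where "x = (p, s, v)" "y = (q, t, w)" "z = (r, u, z')"
    by (metis prod_cases3)
  then show "x \<otimes>\<^bsub>crystal\<^esub> y \<otimes>\<^bsub>crystal\<^esub> z = x \<otimes>\<^bsub>crystal\<^esub> (y \<otimes>\<^bsub>crystal\<^esub> z)"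
    by (simp add: crystal_mult comp_assoc algebra_simps)
next
  fix x :: "(axis \<Rightarrow> axis) \<times> vec \<times> vec"
  obtain p s v where "x = (p, s, v)"
    by (metis prod_cases3)
  then show "\<one>\<^bsub>crystal\<^esub> \<otimes>\<^bsub>crystal\<^esub> x = x"
    by (simp add: crystal_mult crystal_one)
next
  fix x assume "x \<in> carrier crystal"
  then obtain p s v where x: "x = (p, s, v)"
    and p: "bij p" "is_sign s" "\<And>i. even (v i) \<longleftrightarrow> prod s UNIV = 1"
    by (metis crystal_carrier prod_cases3)
  let ?q = "inv_into UNIV p"
  \<comment> \<open>Obtained by solving \<open>y i = s i * x (p i) + v i\<close> for
    \<open>x\<close>, each sign being its own inverse.\<close>
  let ?y = "(?q, \<lambda>i. s (?q i), \<lambda>i. - (s (?q i) * v (?q i)))"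
  have q: "bij ?q"
    using p(1) by (rule bij_imp_bij_inv)
  have "(\<Prod>i\<in>UNIV. s (?q i)) = prod s UNIV"
    using q by (simp add: prod.reindex_bij_betw)
  then have "?y \<in> carrier crystal"
    using q p(2,3) is_sign_odd[OF p(2)]
    by (simp add: crystal_carrier is_sign_def)
  moreover have "?y \<otimes>\<^bsub>crystal\<^esub> x = \<one>\<^bsub>crystal\<^esub>"
    using p(1) is_sign_square[OF p(2)] bij_is_surj[OF p(1)]
    by (simp add: x crystal_mult crystal_one fun_eq_iff surj_f_inv_f)
  ultimately show "\<exists>y\<in>carrier crystal. y \<otimes>\<^bsub>crystal\<^esub> x = \<one>\<^bsub>crystal\<^esub>"
    by blast
qed

interpretation crystal: group crystal
  by (rule group_crystal)

section \<open>The distinguished generators of \<Gamma>\<close>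

definition swap_xy :: "axis \<Rightarrow> axis" where "swap_xy = vec3 Ay Ax Az"
definition swap_yz :: "axis \<Rightarrow> axis" where "swap_yz = vec3 Ax Az Ay"

lemmas swap_simps [simp] =
  swap_xy_def[THEN fun_cong, of Ax, simplified] swap_xy_def[THEN fun_cong, of Ay, simplified]
  swap_xy_def[THEN fun_cong, of Az, simplified] swap_yz_def[THEN fun_cong, of Ax, simplified]
  swap_yz_def[THEN fun_cong, of Ay, simplified] swap_yz_def[THEN fun_cong, of Az, simplified]

lemma bij_axis_iff: "bij p \<longleftrightarrow> p Ax \<noteq> p Ay \<and> p Ax \<noteq> p Az \<and> p Ay \<noteq> p Az" for p :: "axis \<Rightarrow> axis"
proof -
  have "bij p \<longleftrightarrow> inj p"
    using finite_UNIV_inj_surj[of p] by (auto simp: bij_def)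
  also have "\<dots> \<longleftrightarrow> p Ax \<noteq> p Ay \<and> p Ax \<noteq> p Az \<and> p Ay \<noteq> p Az"
    unfolding inj_def by (simp add: all_axis; metis)
  finally show ?thesis .
qed

text \<open>Each permutation appears as a word in the two adjacent transpositions, ready for use
  with closure under composition.\<close>

lemma axis_perm_cases:
  assumes "bij (p :: axis \<Rightarrow> axis)"
  shows "p \<in> {id, swap_xy, swap_yz, swap_xy \<circ> swap_yz, swap_yz \<circ> swap_xy,
    swap_xy \<circ> swap_yz \<circ> swap_xy}"
  using assms unfolding bij_axis_iff
  by (cases "p Ax"; cases "p Ay"; cases "p Az") (simp_all add: fun_eq_axis)

definition gens :: "nat \<Rightarrow> (axis \<Rightarrow> axis) \<times> vec \<times> vec" where
  "gens i = (if i = 0 then (swap_xy, vec3 1 1 (-1), vec3 1 (-1) 1)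
    else if i = 1 then (swap_yz, \<lambda>_. 1, \<lambda>_. 0)
    else (swap_xy, \<lambda>_. -1, \<lambda>_. 1))"

lemma gens_simps:
  "gens 0 = (swap_xy, vec3 1 1 (-1), vec3 1 (-1) 1)"
  "gens 1 = (swap_yz, \<lambda>_. 1, \<lambda>_. 0)"
  "gens (Suc 0) = (swap_yz, \<lambda>_. 1, \<lambda>_. 0)"
  "gens 2 = (swap_xy, \<lambda>_. -1, \<lambda>_. 1)"
  by (simp_all add: gens_def)

lemmas crystal_compute = gens_simps crystal_mult crystal_one fun_eq_axis

lemma gens_carrier: "gens i \<in> carrier crystal"
  by (simp add: gens_def crystal_carrier bij_axis_iff is_sign_def all_axis prod_axis)

lemma gens_square: "gens i \<otimes>\<^bsub>crystal\<^esub> gens i = \<one>\<^bsub>crystal\<^esub>"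
  by (simp add: gens_def crystal_mult crystal_one fun_eq_axis)

text \<open>The axes of the two half-turns meet at right angles in
  \<open>(1, 0, 1/2)\<close>.\<close>

lemma gens_commute: "gens 0 \<otimes>\<^bsub>crystal\<^esub> gens 2 = gens 2 \<otimes>\<^bsub>crystal\<^esub> gens 0"
  by (simp add: crystal_compute)

lemma crystal_powers:
  assumes "x \<in> carrier crystal"
  shows "x [^]\<^bsub>crystal\<^esub> (2::nat) = x \<otimes>\<^bsub>crystal\<^esub> x"
    and "x [^]\<^bsub>crystal\<^esub> (3::nat) = x \<otimes>\<^bsub>crystal\<^esub> x \<otimes>\<^bsub>crystal\<^esub> x"
    and "x [^]\<^bsub>crystal\<^esub> (6::nat)
      = (x \<otimes>\<^bsub>crystal\<^esub> x \<otimes>\<^bsub>crystal\<^esub> x) \<otimes>\<^bsub>crystal\<^esub> (x \<otimes>\<^bsub>crystal\<^esub> x \<otimes>\<^bsub>crystal\<^esub> x)"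
  using assms by (simp_all add: eval_nat_numeral crystal.m_assoc)

lemma gens_mult_carrier: "gens i \<otimes>\<^bsub>crystal\<^esub> gens j \<in> carrier crystal"
  by (intro crystal.m_closed gens_carrier)

text \<open>The product is a rotatory inversion: its linear part is a 3-cycle of the axes with
  signs, and its cube is the inversion in \<open>(3/2, 1/2, 1/2)\<close>. Neither square nor cube is
  a translation, so dividing out translations cannot lower the order 6.\<close>

lemma gens_01_powers:
  defines "x \<equiv> gens 0 \<otimes>\<^bsub>crystal\<^esub> gens 1"
  shows "fst (x [^]\<^bsub>crystal\<^esub> (2::nat)) \<noteq> id"
    and "x [^]\<^bsub>crystal\<^esub> (3::nat) = (id, \<lambda>_. -1, vec3 3 1 1)"
    and "x [^]\<^bsub>crystal\<^esub> (6::nat) = \<one>\<^bsub>crystal\<^esub>"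
  unfolding x_def crystal_powers[OF gens_mult_carrier]
  by (simp_all add: crystal_compute)

lemma gens_12_powers:
  defines "x \<equiv> gens 1 \<otimes>\<^bsub>crystal\<^esub> gens 2"
  shows "fst (x [^]\<^bsub>crystal\<^esub> (2::nat)) \<noteq> id"
    and "x [^]\<^bsub>crystal\<^esub> (3::nat) = (id, \<lambda>_. -1, \<lambda>_. 1)"
    and "x [^]\<^bsub>crystal\<^esub> (6::nat) = \<one>\<^bsub>crystal\<^esub>"
  unfolding x_def crystal_powers[OF gens_mult_carrier]
  by (simp_all add: crystal_compute)

text \<open>The cubes of the two rotatory inversions are point inversions. From them come the
  translations, the pure permutations and the sign changes, and every element of the carrier factors
  as translation, sign change, permutation.\<close>

lemma gens_generate: "generate crystal {gens 0, gens 1, gens 2} = carrier crystal"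
proof
  let ?K = "generate crystal {gens 0, gens 1, gens 2}"
  have sub: "{gens 0, gens 1, gens 2} \<subseteq> carrier crystal"
    using gens_carrier by auto
  show "?K \<subseteq> carrier crystal"
    using crystal.generate_incl[OF sub] .
  have m: "x \<otimes>\<^bsub>crystal\<^esub> y \<in> ?K" if "x \<in> ?K" "y \<in> ?K" for x y
    using that by (rule generate.eng)
  have g: "gens 0 \<in> ?K" "gens 1 \<in> ?K" "gens 2 \<in> ?K"
    by (auto intro: generate.incl)
  define J where "J = (id :: axis \<Rightarrow> axis, (\<lambda>_. -1) :: vec, (\<lambda>_. 1) :: vec)"
  define J0 where "J0 = (id :: axis \<Rightarrow> axis, (\<lambda>_. -1) :: vec, vec3 3 1 1 :: vec)"
  define P where "P p = (p, (\<lambda>_. 1) :: vec, (\<lambda>_. 0) :: vec)" for p :: "axis \<Rightarrow> axis"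
  define T where "T v = (id :: axis \<Rightarrow> axis, (\<lambda>_. 1) :: vec, v)" for v :: vec
  define S where "S s v = (id :: axis \<Rightarrow> axis, s, v)" for s v :: vec
  note defs = J_def J0_def P_def T_def S_def
  have J: "J \<in> ?K" and J0: "J0 \<in> ?K"
    using gens_12_powers(2) gens_01_powers(2) g m
    unfolding crystal_powers[OF gens_mult_carrier] defs by metis+
  \<comment> \<open>Composing with the inversion \<open>J\<close> cancels the signs and the shift of
    \<open>gens 2\<close>.\<close>
  have "J \<otimes>\<^bsub>crystal\<^esub> gens 2 = P swap_xy" "gens 1 = P swap_yz"
    by (simp_all add: defs crystal_compute)
  then have Pg: "P swap_xy \<in> ?K" "P swap_yz \<in> ?K"
    using J g m by metis+
  have "P p \<otimes>\<^bsub>crystal\<^esub> P q = P (q \<circ> p)" for p q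
    by (simp add: defs crystal_mult)
  then have Pcomp: "P (q \<circ> p) \<in> ?K" if "P p \<in> ?K" "P q \<in> ?K" for p q
    using m that by metis
  have "P id = \<one>\<^bsub>crystal\<^esub>"
    by (simp add: defs crystal_one)
  then have "P id \<in> ?K"
    using generate.one by metis
  then have Pall: "P p \<in> ?K" if "bij p" for p
    using axis_perm_cases[OF that] Pg Pcomp by auto
  have Tadd: "T u \<otimes>\<^bsub>crystal\<^esub> T w = T (\<lambda>i. u i + w i)" for u w
    by (simp add: defs crystal_mult add.commute)
  have Tpm: "T (vec3 2 0 0) \<in> ?K" "T (vec3 (-2) 0 0) \<in> ?K"
  proof -
    \<comment> \<open>Two point inversions compose to the translation by twice the difference
      \<open>(1, 0, 0)\<close> of their centres.\<close>
    have "J0 \<otimes>\<^bsub>crystal\<^esub> J = T (vec3 2 0 0)" "J \<otimes>\<^bsub>crystal\<^esub> J0 = T (vec3 (-2) 0 0)"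
      by (simp_all add: defs crystal_compute)
    then show "T (vec3 2 0 0) \<in> ?K" "T (vec3 (-2) 0 0) \<in> ?K"
      using J J0 m by metis+
  qed
  have Tn: "T (vec3 (2 * int n) 0 0) \<in> ?K \<and> T (vec3 (- (2 * int n)) 0 0) \<in> ?K" for n
  proof (induction n)
    case 0
    have "T (vec3 (2 * int 0) 0 0) = \<one>\<^bsub>crystal\<^esub>" "T (vec3 (- (2 * int 0)) 0 0) = \<one>\<^bsub>crystal\<^esub>"
      by (simp_all add: defs crystal_compute)
    then show ?case
      using generate.one by metis
  next
    case (Suc n)
    have "T (vec3 (2 * int n) 0 0) \<otimes>\<^bsub>crystal\<^esub> T (vec3 2 0 0) = T (vec3 (2 * int (Suc n)) 0 0)"
      "T (vec3 (- (2 * int n)) 0 0) \<otimes>\<^bsub>crystal\<^esub> T (vec3 (-2) 0 0)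
        = T (vec3 (- (2 * int (Suc n))) 0 0)"
      by (simp_all add: defs crystal_compute)
    then show ?case
      using m Suc Tpm by metis
  qed
  have Tx: "T (vec3 a 0 0) \<in> ?K" if even: "even a" for a
  proof -
    obtain k where "a = 2 * k" using even by blast
    then show ?thesis
      using Tn[of "nat k"] Tn[of "nat (- k)"] by (cases "k \<ge> 0") auto
  qed
  have "P swap_xy \<otimes>\<^bsub>crystal\<^esub> T (vec3 a 0 0) \<otimes>\<^bsub>crystal\<^esub> P swap_xy = T (vec3 0 a 0)" for a
    by (simp add: defs crystal_compute)
  then have Ty: "T (vec3 0 a 0) \<in> ?K" if "even a" for a
    using Tx[OF that] Pg m by metis
  have "P swap_yz \<otimes>\<^bsub>crystal\<^esub> T (vec3 0 a 0) \<otimes>\<^bsub>crystal\<^esub> P swap_yz = T (vec3 0 0 a)" for a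
    by (simp add: defs crystal_compute)
  then have Tz: "T (vec3 0 0 a) \<in> ?K" if "even a" for a
    using Ty[OF that] Pg m by metis
  have Tall: "T v \<in> ?K" if ev: "\<And>i. even (v i)" for v
  proof -
    have "T (vec3 (v Ax) 0 0) \<otimes>\<^bsub>crystal\<^esub> T (vec3 0 (v Ay) 0) \<otimes>\<^bsub>crystal\<^esub> T (vec3 0 0 (v Az)) = T v"
      unfolding Tadd by (simp add: defs fun_eq_axis)
    then show ?thesis
      using Tx[OF ev] Ty[OF ev] Tz[OF ev] m by metis
  qed
  have Sz: "S (vec3 (-1) (-1) 1) (\<lambda>_. 0) \<in> ?K"
  proof -
    \<comment> \<open>Undoing the swap in \<open>gens 0\<close> and composing with \<open>J\<close>
      leaves the half-turn about the z-direction with shift \<open>(0, 2, 0)\<close>, which the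
      translation removes.\<close>
    have "T (vec3 0 (-2) 0) \<otimes>\<^bsub>crystal\<^esub> (J \<otimes>\<^bsub>crystal\<^esub> gens 0 \<otimes>\<^bsub>crystal\<^esub> P swap_xy)
        = S (vec3 (-1) (-1) 1) (\<lambda>_. 0)"
      by (simp add: defs crystal_compute)
    then show ?thesis
      using Ty[of "-2"] J g Pg m by (metis even_minus even_numeral)
  qed
  have Sx: "S (vec3 1 (-1) (-1)) (\<lambda>_. 0) \<in> ?K"
  proof -
    let ?q = "P (swap_xy \<circ> swap_yz \<circ> swap_xy)"
    have "?q \<otimes>\<^bsub>crystal\<^esub> S (vec3 (-1) (-1) 1) (\<lambda>_. 0) \<otimes>\<^bsub>crystal\<^esub> ?q
        = S (vec3 1 (-1) (-1)) (\<lambda>_. 0)"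
      by (simp add: defs crystal_compute)
    moreover have "?q \<in> ?K"
      by (intro Pcomp Pg)
    ultimately show ?thesis
      using Sz m by metis
  qed
  have Sy: "S (vec3 (-1) 1 (-1)) (\<lambda>_. 0) \<in> ?K"
  proof -
    have "S (vec3 1 (-1) (-1)) (\<lambda>_. 0) \<otimes>\<^bsub>crystal\<^esub> S (vec3 (-1) (-1) 1) (\<lambda>_. 0)
        = S (vec3 (-1) 1 (-1)) (\<lambda>_. 0)"
      by (simp add: defs crystal_compute)
    then show ?thesis
      using Sx Sz m by metis
  qed
  have Seven: "S s (\<lambda>_. 0) \<in> ?K" if "is_sign s" "prod s UNIV = 1" for s
  proof -
    have "s \<in> {\<lambda>_. 1, vec3 (-1) (-1) 1, vec3 1 (-1) (-1), vec3 (-1) 1 (-1)}"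
      using that unfolding is_sign_def all_axis prod_axis insert_iff fun_eq_axis by auto
    moreover have "S (\<lambda>_. 1) (\<lambda>_. 0) = \<one>\<^bsub>crystal\<^esub>"
      by (simp add: defs crystal_one)
    ultimately show ?thesis
      using Sx Sy Sz generate.one by auto
  qed
  have Sodd: "S s (\<lambda>_. 1) \<in> ?K" if s: "is_sign s" "prod s UNIV \<noteq> 1" for s
  proof -
    have "is_sign (\<lambda>i. - s i)" "prod (\<lambda>i. - s i) UNIV = 1"
      using s is_sign_prod[OF s(1)] by (auto simp: is_sign_def prod_axis)
    then have "J \<otimes>\<^bsub>crystal\<^esub> S (\<lambda>i. - s i) (\<lambda>_. 0) \<in> ?K"
      using Seven J m by blast
    then show ?thesis
      by (simp add: defs crystal_mult)
  qed
  show "carrier crystal \<subseteq> ?K"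
  proof
    fix x assume "x \<in> carrier crystal"
    then obtain p s v where x: "x = (p, s, v)"
      and p: "bij p" "is_sign s" "\<And>i. even (v i) \<longleftrightarrow> prod s UNIV = 1"
      by (metis crystal_carrier prod_cases3)
    \<comment> \<open>\<open>c\<close> is the common parity of the coordinates of \<open>v\<close>,
      so \<open>v i - c\<close> is even and gives a translation already generated.\<close>
    define c :: int where "c = (if prod s UNIV = 1 then 0 else 1)"
    have "S s (\<lambda>_. c) \<in> ?K"
      using Seven[OF p(2)] Sodd[OF p(2)] by (simp add: c_def)
    moreover have "T (\<lambda>i. v i - c) \<in> ?K"
      using p(3) by (intro Tall) (simp add: c_def)
    moreover have "T (\<lambda>i. v i - c) \<otimes>\<^bsub>crystal\<^esub> S s (\<lambda>_. c) \<otimes>\<^bsub>crystal\<^esub> P p = x"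
      by (simp add: defs crystal_mult x)
    ultimately show "x \<in> ?K"
      using Pall[OF p(1)] m by metis
  qed
qed

text \<open>
  Points are doubled, so that the half-integral fixed points of the two dihedral subgroups
  become integral.
\<close>

definition act :: "(axis \<Rightarrow> axis) \<times> vec \<times> vec \<Rightarrow> vec \<Rightarrow> vec" where
  "act = (\<lambda>(p, s, v) c i. s i * c (p i) + 2 * v i)"

lemma act_mult: "act (x \<otimes>\<^bsub>crystal\<^esub> y) c = act x (act y c)"
  by (cases x; cases y) (simp add: act_def crystal_mult algebra_simps)

lemma act_one: "act \<one>\<^bsub>crystal\<^esub> c = c"
  by (simp add: act_def crystal_one)

lemma generate_fixes:
  assumes "A \<subseteq> carrier crystal" "\<And>x. x \<in> A \<Longrightarrow> act x c = c" "y \<in> generate crystal A"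
  shows "act y c = c"
  using assms(3)
proof induction
  case one
  then show ?case by (rule act_one)
next
  case (incl h)
  then show ?case by (rule assms(2))
next
  case (inv h)
  then have "c = act (inv\<^bsub>crystal\<^esub> h \<otimes>\<^bsub>crystal\<^esub> h) c"
    using assms(1) by (subst crystal.l_inv) (auto simp: act_one)
  then show ?case
    using assms(2)[OF inv] by (simp add: act_mult)
next
  case (eng h k)
  then show ?case by (simp add: act_mult)
qed

text \<open>\<open>vec3 3 1 1\<close> is the doubled centre of the inversion found in
  \<open>gens_01_powers\<close>.\<close>

lemma generate_01_fixes:
  assumes "y \<in> generate crystal {gens 0, gens 1}"
  shows "act y (vec3 3 1 1) = vec3 3 1 1"
proof (rule generate_fixes[OF _ _ assms])
  show "{gens 0, gens 1} \<subseteq> carrier crystal"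
    by (simp add: gens_carrier)
qed (auto simp: gens_simps act_def fun_eq_axis)

lemma generate_12_fixes:
  assumes "y \<in> generate crystal {gens 1, gens 2}"
  shows "act y (\<lambda>_. 1) = (\<lambda>_. 1)"
proof (rule generate_fixes[OF _ _ assms])
  show "{gens 1, gens 2} \<subseteq> carrier crystal"
    by (simp add: gens_carrier)
qed (auto simp: gens_simps act_def fun_eq_axis)

section \<open>Finite quotients by invariant lattices\<close>

text \<open>\<open>r\<close> labels the cosets of \<open>L\<close> in the integer lattice, so
  \<open>range r\<close> has as many elements as the index of \<open>L\<close>. As equality of
  labels is an equivalence relation, \<open>r_eq_iff\<close> also makes \<open>L\<close> an additive
  subgroup. \<open>proper\<close> is what saves the intersection property.\<close>

locale invariant_lattice =
  fixes L :: "vec set" and r :: "vec \<Rightarrow> 'r"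
  assumes r_eq_iff: "r v = r w \<longleftrightarrow> (\<lambda>i. v i - w i) \<in> L"
    and invariant: "u \<in> L \<Longrightarrow> bij p \<Longrightarrow> is_sign s \<Longrightarrow> (\<lambda>i. s i * u (p i)) \<in> L"
    and proper: "vec3 1 0 0 \<notin> L"
begin

lemma zero_mem: "(\<lambda>_. 0) \<in> L"
  using r_eq_iff[of undefined undefined] by simp

lemma uminus_mem: "u \<in> L \<Longrightarrow> (\<lambda>i. - u i) \<in> L"
  using r_eq_iff[of "\<lambda>_. 0" u] r_eq_iff[of u "\<lambda>_. 0"] by simp

text \<open>Transitivity through zero: \<open>u\<close> and \<open>- w\<close> both carry the label
  of the zero vector, so their difference lies in \<open>L\<close>.\<close>

lemma add_mem: "u \<in> L \<Longrightarrow> w \<in> L \<Longrightarrow> (\<lambda>i. u i + w i) \<in> L"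
  using r_eq_iff[of "\<lambda>_. 0" u] r_eq_iff[of u "\<lambda>_. 0"] r_eq_iff[of "\<lambda>_. 0" "\<lambda>i. - w i"]
    r_eq_iff[of u "\<lambda>i. - w i"] by simp

text \<open>A concrete label for cosets of \<open>shifts\<close>. On the carrier the parity of each
  \<open>v i\<close> is determined by \<open>s\<close>, so \<open>div 2\<close> loses no
  information.\<close>

definition code :: "(axis \<Rightarrow> axis) \<times> vec \<times> vec \<Rightarrow> (axis \<Rightarrow> axis) \<times> vec \<times> 'r" where
  "code = (\<lambda>(p, s, v). (p, s, r (\<lambda>i. v i div 2)))"

definition shifts :: "((axis \<Rightarrow> axis) \<times> vec \<times> vec) set" where
  "shifts = {(id, \<lambda>_. 1, \<lambda>i. 2 * u i) | u. u \<in> L}"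

lemma shiftsI: "u \<in> L \<Longrightarrow> (id, \<lambda>_. 1, \<lambda>i. 2 * u i) \<in> shifts"
  by (auto simp: shifts_def)

text \<open>Conjugating a translation by an isometry applies the linear part to its vector, and
  \<open>L\<close> is invariant under all signed permutations.\<close>

lemma shifts_normal: "shifts \<lhd> crystal"
proof (rule crystal.normal_invI)
  have sub: "shifts \<subseteq> carrier crystal"
    by (auto simp: shifts_def crystal_carrier is_sign_def)
  show "subgroup shifts crystal"
  proof (rule crystal.subgroupI[OF sub])
    show "shifts \<noteq> {}"
      using zero_mem by (auto simp: shifts_def)
    show "a \<otimes>\<^bsub>crystal\<^esub> b \<in> shifts" if ab: "a \<in> shifts" "b \<in> shifts" for a b
    proof -
      obtain u w where uw: "a = (id, \<lambda>_. 1, \<lambda>i. 2 * u i)" "u \<in> L"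
          "b = (id, \<lambda>_. 1, \<lambda>i. 2 * w i)" "w \<in> L"
        using ab unfolding shifts_def by blast
      then have "a \<otimes>\<^bsub>crystal\<^esub> b = (id, \<lambda>_. 1, \<lambda>i. 2 * (w i + u i))"
        by (simp add: crystal_mult)
      then show ?thesis
        using shiftsI[OF add_mem[OF uw(4,2)]] by simp
    qed
    show "inv\<^bsub>crystal\<^esub> a \<in> shifts" if a: "a \<in> shifts" for a
    proof -
      obtain u where u: "a = (id, \<lambda>_. 1, \<lambda>i. 2 * u i)" "u \<in> L"
        using a by (auto simp: shifts_def)
      let ?b = "(id, \<lambda>_. 1, \<lambda>i. 2 * (- u i))"
      have b: "?b \<in> shifts"
        by (rule shiftsI[OF uminus_mem[OF u(2)]])
      have "inv\<^bsub>crystal\<^esub> a = ?b"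
        using a b sub by (intro crystal.inv_equality) (auto simp: u crystal_mult crystal_one)
      then show ?thesis
        using b by simp
    qed
  qed
next
  have sub: "shifts \<subseteq> carrier crystal"
    by (auto simp: shifts_def crystal_carrier is_sign_def)
  fix x a assume x: "x \<in> carrier crystal" and a: "a \<in> shifts"
  obtain p s v where xp: "x = (p, s, v)"
    by (metis prod_cases3)
  obtain u where u: "a = (id, \<lambda>_. 1, \<lambda>i. 2 * u i)" "u \<in> L"
    using a by (auto simp: shifts_def)
  let ?b = "(id, \<lambda>_. 1, \<lambda>i. 2 * (s i * u (p i)))"
  have b: "?b \<in> shifts"
    using invariant[OF u(2)] x unfolding xp crystal_carrier by (intro shiftsI) blast
  have "x \<otimes>\<^bsub>crystal\<^esub> a = ?b \<otimes>\<^bsub>crystal\<^esub> x"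
    by (simp add: xp u crystal_mult algebra_simps)
  then have "x \<otimes>\<^bsub>crystal\<^esub> a \<otimes>\<^bsub>crystal\<^esub> inv\<^bsub>crystal\<^esub> x = ?b"
    using x subsetD[OF sub a] subsetD[OF sub b]
      crystal.inv_solve_right[of ?b "x \<otimes>\<^bsub>crystal\<^esub> a" x] by simp
  then show "x \<otimes>\<^bsub>crystal\<^esub> a \<otimes>\<^bsub>crystal\<^esub> inv\<^bsub>crystal\<^esub> x \<in> shifts"
    using b by simp
qed

text \<open>Equal signs force equal parities of \<open>v\<close> and \<open>w\<close>, so the
  difference of the rounded halves is exactly half of the difference.\<close>

lemma code_eq_iff:
  assumes "(p, s, v) \<in> carrier crystal" "(q, t, w) \<in> carrier crystal"
  shows "code (p, s, v) = code (q, t, w) \<longleftrightarrow> p = q \<and> s = t \<and> (\<exists>u\<in>L. v = (\<lambda>i. 2 * u i + w i))"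
proof -
  have "r (\<lambda>i. v i div 2) = r (\<lambda>i. w i div 2) \<longleftrightarrow> (\<exists>u\<in>L. v = (\<lambda>i. 2 * u i + w i))" if "s = t"
  proof -
    have par: "even (v i) \<longleftrightarrow> even (w i)" for i
      using assms that by (simp add: crystal_carrier)
    have "v = (\<lambda>i. 2 * u i + w i) \<longleftrightarrow> u = (\<lambda>i. v i div 2 - w i div 2)" for u
    proof -
      have "v i = 2 * u i + w i \<longleftrightarrow> u i = v i div 2 - w i div 2" for i
        using par[of i] by presburger
      then show ?thesis by (simp add: fun_eq_iff)
    qed
    then show ?thesis
      by (auto simp: r_eq_iff)
  qed
  then show ?thesis
    by (auto simp: code_def)
qed

lemma code_eq_iff_translation:
  assumes x: "x \<in> carrier crystal" and y: "y \<in> carrier crystal"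
  shows "code x = code y \<longleftrightarrow> x \<otimes>\<^bsub>crystal\<^esub> inv\<^bsub>crystal\<^esub> y \<in> shifts"
proof -
  obtain p s v q t w where xy: "x = (p, s, v)" "y = (q, t, w)"
    by (metis prod_cases3)
  have sub: "shifts \<subseteq> carrier crystal"
    using shifts_normal by (simp add: normal_def subgroup.subset)
  have "n = x \<otimes>\<^bsub>crystal\<^esub> inv\<^bsub>crystal\<^esub> y \<longleftrightarrow> x = n \<otimes>\<^bsub>crystal\<^esub> y" if "n \<in> shifts" for n
    using crystal.inv_solve_right[OF subsetD[OF sub that] x y] .
  then have "x \<otimes>\<^bsub>crystal\<^esub> inv\<^bsub>crystal\<^esub> y \<in> shifts
      \<longleftrightarrow> (\<exists>n\<in>shifts. x = n \<otimes>\<^bsub>crystal\<^esub> y)"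
    by (metis (no_types))
  also have "\<dots> \<longleftrightarrow> code x = code y"
    unfolding xy code_eq_iff[OF x[unfolded xy] y[unfolded xy]]
    by (auto simp: shifts_def crystal_mult add.commute)
  finally show ?thesis by simp
qed

lemma code_image: "code ` carrier crystal = {p. bij p} \<times> {s. is_sign s} \<times> range r"
proof
  show "code ` carrier crystal \<subseteq> {p. bij p} \<times> {s. is_sign s} \<times> range r"
    by (auto simp: code_def crystal_carrier)
  show "{p. bij p} \<times> {s. is_sign s} \<times> range r \<subseteq> code ` carrier crystal"
  proof clarify
    fix p :: "axis \<Rightarrow> axis" and s u :: vec assume ps: "bij p" "is_sign s"
    \<comment> \<open>The offset 0 or 1 supplies the parity demanded by \<open>s\<close> and
      disappears under \<open>div 2\<close>.\<close>
    let ?v = "\<lambda>i. 2 * u i + (if prod s UNIV = 1 then 0 else 1)"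
    have "(p, s, ?v) \<in> carrier crystal" "code (p, s, ?v) = (p, s, r u)"
      using ps by (auto simp: crystal_carrier code_def)
    then show "(p, s, r u) \<in> code ` carrier crystal"
      by (metis imageI)
  qed
qed

lemma card_code: "card (code ` carrier crystal) = 48 * card (range r)"
proof -
  have "{p :: axis \<Rightarrow> axis. bij p} = {p. p permutes UNIV}"
    by (auto intro: bij_imp_permutes permutes_bij)
  then have "card {p :: axis \<Rightarrow> axis. bij p} = 6"
    by (simp add: card_permutations[OF card_UNIV_axis] fact_numeral)
  moreover have "{s. is_sign s} = PiE UNIV (\<lambda>_. {1, -1})"
    by (auto simp: is_sign_def PiE_def extensional_def Pi_def)
  then have "card {s. is_sign s} = 8"
    by (simp add: card_PiE eval_nat_numeral)
  ultimately show ?thesis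
    by (simp add: code_image card_cartesian_product)
qed

text \<open>This is the intersection property in the quotient. Equal codes give \<open>x\<close> and
  \<open>y\<close> the same linear part and translation parts differing by \<open>2 * u\<close> with
  \<open>u\<close> in \<open>L\<close>. The two fixed points then determine \<open>u\<close>, and
  \<open>proper\<close> leaves only a linear part that fixes the first unit vector.\<close>

lemma stabilizers_meet:
  assumes "x \<in> carrier crystal" "y \<in> carrier crystal" "code x = code y"
    and "act x (vec3 3 1 1) = vec3 3 1 1" "act y (\<lambda>_. 1) = (\<lambda>_. 1)"
  shows "x \<in> {\<one>\<^bsub>crystal\<^esub>, gens 1}"
proof -
  obtain p s v q t w where xy: "x = (p, s, v)" "y = (q, t, w)"
    by (metis prod_cases3)
  obtain u where u: "q = p" "t = s" "u \<in> L" "\<And>i. v i = 2 * u i + w i"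
    using assms(3)
    unfolding xy code_eq_iff[OF assms(1)[unfolded xy] assms(2)[unfolded xy]] by auto
  have p: "bij p" "is_sign s" "\<And>i. even (v i) \<longleftrightarrow> prod s UNIV = 1"
    using assms(1) by (simp_all add: xy crystal_carrier)
  have s: "s i = 1 \<or> s i = -1" for i
    using p(2) by (simp add: is_sign_def)
  have v: "s i * vec3 3 1 1 (p i) + 2 * v i = vec3 3 1 1 i" for i
    using fun_cong[OF assms(4), of i] by (simp add: xy act_def)
  have w: "s i + 2 * w i = 1" for i
    using fun_cong[OF assms(5), of i] by (simp add: xy u act_def)
  \<comment> \<open>The translation parts differ by \<open>e - A e\<close>, where \<open>e\<close> is the first unit vector, half the
     difference of the two doubled fixed points, and \<open>A\<close> is the common linear part.\<close>
  have e: "2 * u i = vec3 1 0 0 i - s i * vec3 1 0 0 (p i)" for i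
  proof -
    have "vec3 3 1 1 j = 1 + 2 * (vec3 1 0 0 j :: int)" for j
      by (cases j) auto
    then have "s i * (1 + 2 * vec3 1 0 0 (p i)) + 2 * v i = 1 + 2 * vec3 1 0 0 i"
      using v[of i] by simp
    then show ?thesis
      using w[of i] u(4)[of i] by (simp add: algebra_simps)
  qed
  \<comment> \<open>If the x-axis were moved, the first coordinate of \<open>2 * u\<close> would be
    1, which is odd.\<close>
  have px: "p Ax = Ax"
  proof (rule ccontr)
    assume "p Ax \<noteq> Ax"
    then have "2 * u Ax = 1"
      using e[of Ax] by (cases "p Ax") auto
    then show False by presburger
  qed
  then have pyz: "p Ay \<noteq> Ax" "p Az \<noteq> Ax"
    using p(1) by (auto simp: bij_axis_iff)
  \<comment> \<open>Reversing the x-axis would make \<open>u\<close> the first unit vector, which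
    \<open>proper\<close> excludes.\<close>
  have "s Ax = 1"
  proof (rule ccontr)
    assume "s Ax \<noteq> 1"
    then have "u = vec3 1 0 0"
      using e[of Ax] e[of Ay] e[of Az] px pyz s[of Ax]
      by (cases "p Ay"; cases "p Az") (auto simp: fun_eq_axis)
    then show False using u(3) proper by simp
  qed
  then have "v Ax = 0"
    using v[of Ax] px by simp
  \<comment> \<open>The sign product ties the parities of all coordinates together, so one even
    coordinate makes all even. A sign -1 on another axis would need \<open>v i = 1\<close>.\<close>
  then have ev: "even (v i)" for i
    using p(3)[of Ax] p(3)[of i] by simp
  have sv: "s i = 1 \<and> v i = 0" for i
  proof (cases "i = Ax")
    case False
    then have "s i + 2 * v i = 1"
      using v[of i] pyz by (cases i; cases "p i") auto
    then show ?thesis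
      using s[of i] ev[of i] by (elim disjE) auto
  qed (use \<open>s Ax = 1\<close> \<open>v Ax = 0\<close> in auto)
  then have "s = (\<lambda>_. 1)" "v = (\<lambda>_. 0)"
    by (auto simp: fun_eq_iff)
  moreover have "p = id \<or> p = swap_yz"
    using px pyz p(1) unfolding bij_axis_iff
    by (cases "p Ay"; cases "p Az") (auto simp: fun_eq_axis)
  ultimately show ?thesis
    by (auto simp: xy crystal_one gens_simps)
qed

text \<open>Numbering the finitely many codes by naturals gives a map \<open>f\<close> whose fibres
  are the cosets of \<open>shifts\<close>; transporting the multiplication along \<open>f\<close>
  realises the quotient inside \<open>nat\<close>. An element common to both dihedral subgroups
  lifts to elements \<open>x\<close>, \<open>y\<close> with equal codes, to which
  \<open>stabilizers_meet\<close> applies.\<close>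

lemma string_C_quotient:
  assumes "finite (range r)"
  shows "\<exists>(G :: nat monoid) \<rho>. string_C_group3 G \<rho> \<and>
    order G = 48 * card (range r) \<and> schlafli_type G \<rho> = (6, 6)"
proof -
  have "card (range r) > 0"
    using assms by (simp add: card_gt_0_iff)
  then have "finite (code ` carrier crystal)"
    using card_code by (intro card_ge_0_finite) simp
  then obtain h :: "_ \<Rightarrow> nat" where h: "inj_on h (code ` carrier crystal)"
    using finite_imp_inj_to_nat_seg by metis
  define f where "f = h \<circ> code"
  define G where "G = image_group f crystal"
  define \<rho> where "\<rho> = f \<circ> gens"
  have f_eq: "f x = f y \<longleftrightarrow> code x = code y" if "x \<in> carrier crystal" "y \<in> carrier crystal" for x y
    using h that by (auto simp: f_def inj_on_def)
  have weak: "weak_group_morphism f shifts crystal"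
    using shifts_normal f_eq code_eq_iff_translation by (intro weak_group_morphismsI) auto
  interpret f: group_hom crystal G f
    unfolding G_def by (rule crystal.weak_group_morphism_group_hom[OF weak])
  have carrier: "carrier G = f ` carrier crystal"
    by (simp add: G_def image_group_carrier)
  have one_iff: "f x = \<one>\<^bsub>G\<^esub> \<longleftrightarrow> x \<in> shifts" if "x \<in> carrier crystal" for x
    using crystal.weak_group_morphism_ker[OF weak] that unfolding G_def kernel_def by blast
  have not_shift: "x \<notin> shifts" if "fst x \<noteq> id \<or> fst (snd x) \<noteq> (\<lambda>_. 1)" for x
    using that by (auto simp: shifts_def)
  have ord6: "group.ord G (f x) = 6" if "x \<in> carrier crystal" "x [^]\<^bsub>crystal\<^esub> (6::nat) = \<one>\<^bsub>crystal\<^esub>"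
    "x [^]\<^bsub>crystal\<^esub> (2::nat) \<notin> shifts" "x [^]\<^bsub>crystal\<^esub> (3::nat) \<notin> shifts" for x
    using that one_iff by (intro f.H.ord_eqI_6) (simp_all flip: f.hom_nat_pow)
  have gen: "generate G (f ` A) = f ` generate crystal A" if "A \<subseteq> carrier crystal" for A
    using f.generate_img[OF that] by simp
  have ne: "(\<lambda>_. - 1 :: int) \<noteq> (\<lambda>_ :: axis. 1)"
    by (simp add: fun_eq_axis)
  have "group.ord G (f (gens 0 \<otimes>\<^bsub>crystal\<^esub> gens 1)) = 6"
    using gens_01_powers ne by (intro ord6 gens_mult_carrier not_shift) auto
  moreover have "group.ord G (f (gens 1 \<otimes>\<^bsub>crystal\<^esub> gens 2)) = 6"
    using gens_12_powers ne by (intro ord6 gens_mult_carrier not_shift) auto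
  ultimately have type: "schlafli_type G \<rho> = (6, 6)"
    by (simp add: schlafli_type_def \<rho>_def gens_carrier)
  have "order G = 48 * card (range r)"
    using card_code card_image[OF h] by (simp add: order_def carrier f_def image_comp)
  moreover have "string_C_group3 G \<rho>"
  proof (rule f.H.string_C_group3I)
    show "\<rho> 0 \<in> carrier G" "\<rho> 1 \<in> carrier G" "\<rho> 2 \<in> carrier G"
      by (simp_all add: \<rho>_def gens_carrier)
    show "\<rho> 0 \<otimes>\<^bsub>G\<^esub> \<rho> 0 = \<one>\<^bsub>G\<^esub>" "\<rho> 1 \<otimes>\<^bsub>G\<^esub> \<rho> 1 = \<one>\<^bsub>G\<^esub>" "\<rho> 2 \<otimes>\<^bsub>G\<^esub> \<rho> 2 = \<one>\<^bsub>G\<^esub>"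
      by (simp_all add: \<rho>_def gens_carrier gens_square flip: f.hom_mult)
    show "\<rho> 0 \<otimes>\<^bsub>G\<^esub> \<rho> 2 = \<rho> 2 \<otimes>\<^bsub>G\<^esub> \<rho> 0"
      by (simp add: \<rho>_def gens_carrier gens_commute flip: f.hom_mult)
    have "gens i \<notin> shifts" for i
      by (rule not_shift) (simp add: gens_def fun_eq_axis)
    then show "\<rho> 0 \<noteq> \<one>\<^bsub>G\<^esub>" "\<rho> 1 \<noteq> \<one>\<^bsub>G\<^esub>" "\<rho> 2 \<noteq> \<one>\<^bsub>G\<^esub>"
      by (simp_all add: \<rho>_def gens_carrier one_iff)
    show "\<rho> 0 \<noteq> \<rho> 1" "\<rho> 2 \<noteq> \<rho> 1"
      by (simp_all add: \<rho>_def f_eq gens_carrier) (simp_all add: code_def gens_def fun_eq_axis)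
    have img: "{\<rho> 0, \<rho> 1, \<rho> 2} = f ` {gens 0, gens 1, gens 2}"
      "{\<rho> 0, \<rho> 1} = f ` {gens 0, gens 1}" "{\<rho> 1, \<rho> 2} = f ` {gens 1, gens 2}"
      by (auto simp: \<rho>_def)
    show "generate G {\<rho> 0, \<rho> 1, \<rho> 2} = carrier G"
      unfolding img(1) carrier by (subst gen) (simp_all add: gens_carrier gens_generate del: One_nat_def)
    show "generate G {\<rho> 0, \<rho> 1} \<inter> generate G {\<rho> 1, \<rho> 2} \<subseteq> {\<one>\<^bsub>G\<^esub>, \<rho> 1}"
    proof
      fix z assume "z \<in> generate G {\<rho> 0, \<rho> 1} \<inter> generate G {\<rho> 1, \<rho> 2}"
      moreover have sub: "{gens 0, gens 1} \<subseteq> carrier crystal" "{gens 1, gens 2} \<subseteq> carrier crystal"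
        using gens_carrier by auto
      ultimately obtain x y where z: "z = f x" "f x = f y"
        and x: "x \<in> generate crystal {gens 0, gens 1}" and y: "y \<in> generate crystal {gens 1, gens 2}"
        unfolding img gen[OF sub(1)] gen[OF sub(2)] by blast
      have xy: "x \<in> carrier crystal" "y \<in> carrier crystal"
        using x y crystal.generate_incl[OF sub(1)] crystal.generate_incl[OF sub(2)] by auto
      then have "x \<in> {\<one>\<^bsub>crystal\<^esub>, gens 1}"
        using z(2) f_eq generate_01_fixes[OF x] generate_12_fixes[OF y]
        by (intro stabilizers_meet[of x y]) auto
      then show "z \<in> {\<one>\<^bsub>G\<^esub>, \<rho> 1}"
        using z(1) by (auto simp: \<rho>_def)
    qed
  qed
  ultimately show ?thesis
    using type by blast
qed

end

section \<open>Invariant lattices of every index\<close>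

text \<open>A sign changes \<open>x\<close> by 0 or by \<open>- 2 * x\<close>. Hence congruences
  modulo \<open>2 * m\<close> between sums of multiples of \<open>m\<close> survive sign
  changes.\<close>

lemma sign_dvd_diff:
  assumes "is_sign s" "m dvd x"
  shows "2 * m dvd s i * x - x"
proof -
  have "s i * x - x = 0 \<or> s i * x - x = 2 * (- x)"
    using assms(1) unfolding is_sign_def by (metis mult_1 mult_2 mult_minus1 diff_self diff_conv_add_uminus)
  then show ?thesis
    using assms(2) by (metis dvd_0_right dvd_minus_iff mult_dvd_mono dvd_refl)
qed

text \<open>Joint surjectivity of the three forms makes their residues independent, so every residue
  triple occurs.\<close>

lemma range_three_mods:
  fixes a b c :: int
  assumes "a > 0" "b > 0" "c > 0"
    and "\<And>x y z. \<exists>v :: 'v. k v = x \<and> l v = y \<and> m v = z"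
  shows "finite (range (\<lambda>v. (k v mod a, l v mod b, m v mod c)))"
    and "int (card (range (\<lambda>v. (k v mod a, l v mod b, m v mod c)))) = a * b * c"
proof -
  have "range (\<lambda>v. (k v mod a, l v mod b, m v mod c)) = {0..<a} \<times> {0..<b} \<times> {0..<c}"
  proof
    show "{0..<a} \<times> {0..<b} \<times> {0..<c} \<subseteq> range (\<lambda>v. (k v mod a, l v mod b, m v mod c))"
    proof clarify
      fix x y z assume "x \<in> {0..<a}" "y \<in> {0..<b}" "z \<in> {0..<c}"
      moreover obtain v where "k v = x \<and> l v = y \<and> m v = z"
        using assms(4) by blast
      ultimately show "(x, y, z) \<in> range (\<lambda>v. (k v mod a, l v mod b, m v mod c))"
        by (intro image_eqI[of _ _ v]) auto
    qed
  qed (use assms in auto)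
  then show "finite (range (\<lambda>v. (k v mod a, l v mod b, m v mod c)))"
    and "int (card (range (\<lambda>v. (k v mod a, l v mod b, m v mod c)))) = a * b * c"
    using assms(1-3) by (simp_all add: card_cartesian_product)
qed

text \<open>This is the cubic lattice scaled by \<open>m\<close>; \<open>m > 1\<close> keeps the
  unit vector out.\<close>

lemma primitive_lattice:
  fixes m :: int
  assumes "m > 1"
  defines "r \<equiv> \<lambda>v :: vec. (v Ax mod m, v Ay mod m, v Az mod m)"
  shows "invariant_lattice {v. \<forall>i. m dvd v i} r" "finite (range r)" "int (card (range r)) = m ^ 3"
proof -
  show "invariant_lattice {v. \<forall>i. m dvd v i} r"
  proof
    show "r v = r w \<longleftrightarrow> (\<lambda>i. v i - w i) \<in> {v. \<forall>i. m dvd v i}" for v w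
      by (simp add: r_def all_axis mod_eq_dvd_iff)
    show "vec3 1 0 0 \<notin> {v. \<forall>i. m dvd v i}"
      using assms(1) by (auto simp: all_axis)
  qed auto
  have "\<exists>v :: vec. v Ax = x \<and> v Ay = y \<and> v Az = z" for x y z
    by (rule exI[of _ "vec3 x y z"]) simp
  then show "finite (range r)" "int (card (range r)) = m ^ 3"
    unfolding r_def using assms(1) by (simp_all add: range_three_mods power3_eq_cube)
qed

text \<open>This is \<open>m\<close> times the lattice of integer vectors with even coordinate sum.
  Replacing the last coordinate by the sum is a unimodular change, so the label counts
  \<open>m * m * (2 * m)\<close> cosets.\<close>

lemma face_centred_lattice:
  fixes m :: int
  assumes "m > 0"
  defines "r \<equiv> \<lambda>v :: vec. (v Ax mod m, v Ay mod m, (\<Sum>i\<in>UNIV. v i) mod (2 * m))"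
  shows "invariant_lattice {v. (\<forall>i. m dvd v i) \<and> 2 * m dvd (\<Sum>i\<in>UNIV. v i)} r"
    "finite (range r)" "int (card (range r)) = 2 * m ^ 3"
proof -
  have sum: "(\<Sum>i\<in>UNIV. v i) = v Ax + v Ay + v Az" for v :: vec
    by (simp add: UNIV_axis)
  show "invariant_lattice {v. (\<forall>i. m dvd v i) \<and> 2 * m dvd (\<Sum>i\<in>UNIV. v i)} r"
  proof
    show "r v = r w \<longleftrightarrow> (\<lambda>i. v i - w i) \<in> {v. (\<forall>i. m dvd v i) \<and> 2 * m dvd (\<Sum>i\<in>UNIV. v i)}" for v w
    proof -
      have "m dvd z" if "m dvd x" "m dvd y" "2 * m dvd x + y + z" for x y z
        using that by (metis dvd_add_right_iff dvd_mult_right dvd_add)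
      from this[of "v Ax - w Ax" "v Ay - w Ay" "v Az - w Az"] show ?thesis
        by (auto simp: r_def all_axis mod_eq_dvd_iff sum algebra_simps)
    qed
    show "(\<lambda>i. s i * u (p i)) \<in> {v. (\<forall>i. m dvd v i) \<and> 2 * m dvd (\<Sum>i\<in>UNIV. v i)}"
      if u: "u \<in> {v. (\<forall>i. m dvd v i) \<and> 2 * m dvd (\<Sum>i\<in>UNIV. v i)}" and p: "bij p" and s: "is_sign s"
      for u p s
    proof -
      \<comment> \<open>Permutations preserve the coordinate sum, and sign changes alter it by
        multiples of \<open>2 * m\<close>.\<close>
      have "2 * m dvd (\<Sum>i\<in>UNIV. s i * u (p i) - u (p i))"
        using u s by (intro dvd_sum sign_dvd_diff) auto
      moreover have "(\<Sum>i\<in>UNIV. u (p i)) = (\<Sum>i\<in>UNIV. u i)"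
        using p by (simp add: sum.reindex_bij_betw)
      ultimately show ?thesis
        using u by (auto simp: sum_subtractf dvd_diff_right_iff dvd_diff_left_iff)
    qed
    have "\<not> 2 * m dvd 1"
      using assms(1) zdvd_imp_le[of "2 * m" 1] by auto
    then show "vec3 1 0 0 \<notin> {v. (\<forall>i. m dvd v i) \<and> 2 * m dvd (\<Sum>i\<in>UNIV. v i)}"
      by (simp add: sum)
  qed
  have "\<exists>v :: vec. v Ax = x \<and> v Ay = y \<and> (\<Sum>i\<in>UNIV. v i) = z" for x y z
    by (rule exI[of _ "vec3 x y (z - x - y)"]) (simp add: sum)
  then show "finite (range r)" "int (card (range r)) = 2 * m ^ 3"
    unfolding r_def using assms(1) by (simp_all add: range_three_mods power3_eq_cube)
qed

text \<open>This is \<open>m\<close> times the lattice of integer vectors whose coordinates all have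
  the same parity, expressed through pair sums. The three forms in \<open>r\<close> are again
  unimodular coordinates.\<close>

lemma body_centred_lattice:
  fixes m :: int
  assumes "m > 0"
  defines "r \<equiv> \<lambda>v :: vec. (v Ax mod m, (v Ax + v Ay) mod (2 * m), (v Ax + v Az) mod (2 * m))"
  shows "invariant_lattice {v. (\<forall>i. m dvd v i) \<and> (\<forall>i j. 2 * m dvd v i + v j)} r"
    "finite (range r)" "int (card (range r)) = 4 * m ^ 3"
proof -
  show "invariant_lattice {v. (\<forall>i. m dvd v i) \<and> (\<forall>i j. 2 * m dvd v i + v j)} r"
  proof
    show "r v = r w \<longleftrightarrow> (\<lambda>i. v i - w i) \<in> {v. (\<forall>i. m dvd v i) \<and> (\<forall>i j. 2 * m dvd v i + v j)}" for v w
    proof -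
      \<comment> \<open>The three residues recorded by \<open>r\<close> determine every divisibility
        that defines the lattice.\<close>
      have *: "m dvd y \<and> m dvd z \<and> 2 * m dvd y + z \<and> 2 * m dvd x + x \<and> 2 * m dvd y + y \<and> 2 * m dvd z + z"
        if x: "m dvd x" and "2 * m dvd x + y" "2 * m dvd x + z" for x y z
      proof -
        have yz: "m dvd y" "m dvd z"
          using that by (metis dvd_add_right_iff dvd_mult_right)+
        moreover have "2 * m dvd t + t" if "m dvd t" for t
          using that by (metis mult_2 mult_dvd_mono dvd_refl)
        moreover have "y + z = (x + y) + (x + z) - (x + x)"
          by simp
        ultimately show ?thesis
          using that by (metis dvd_add dvd_diff)
      qed
      show ?thesis
        using *[of "v Ax - w Ax" "v Ay - w Ay" "v Az - w Az"]
        by (auto simp: r_def all_axis mod_eq_dvd_iff algebra_simps)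
    qed
    show "(\<lambda>i. s i * u (p i)) \<in> {v. (\<forall>i. m dvd v i) \<and> (\<forall>i j. 2 * m dvd v i + v j)}"
      if u: "u \<in> {v. (\<forall>i. m dvd v i) \<and> (\<forall>i j. 2 * m dvd v i + v j)}" and s: "is_sign s"
      for u p s
    proof -
      have "2 * m dvd s i * u (p i) + s j * u (p j)" for i j
      proof -
        have "2 * m dvd (s i * u (p i) - u (p i)) + (s j * u (p j) - u (p j)) + (u (p i) + u (p j))"
          using u s by (intro dvd_add[OF dvd_add] sign_dvd_diff) auto
        then show ?thesis by simp
      qed
      then show ?thesis using u by auto
    qed
    have "\<not> 2 * m dvd 1"
      using assms(1) zdvd_imp_le[of "2 * m" 1] by auto
    then show "vec3 1 0 0 \<notin> {v. (\<forall>i. m dvd v i) \<and> (\<forall>i j. 2 * m dvd v i + v j)}"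
      by (auto simp: all_axis)
  qed
  have "\<exists>v :: vec. v Ax = x \<and> v Ax + v Ay = y \<and> v Ax + v Az = z" for x y z
    by (rule exI[of _ "vec3 x (y - x) (z - x)"]) simp
  then show "finite (range r)" "int (card (range r)) = 4 * m ^ 3"
    unfolding r_def using assms(1) by (simp_all add: range_three_mods power3_eq_cube)
qed

text \<open>With \<open>m = 2 ^ j\<close> the three lattice types have index \<open>m ^ 3\<close>,
  \<open>2 * m ^ 3\<close> and \<open>4 * m ^ 3\<close>, so the residue of \<open>e\<close> modulo 3
  selects the type.\<close>

lemma invariant_lattice_exists:
  assumes "e \<ge> 1"
  shows "\<exists>L (r :: vec \<Rightarrow> int \<times> int \<times> int).
    invariant_lattice L r \<and> finite (range r) \<and> card (range r) = 2 ^ e"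
proof -
  obtain j k where e: "e = 3 * j + k" "k < 3"
    by (metis div_mult_mod_eq mod_less_divisor mult.commute zero_less_numeral)
  define m :: int where "m = 2 ^ j"
  have m: "m > 0" "m ^ 3 = 2 ^ (3 * j)"
    by (simp_all add: m_def mult.commute flip: power_mult)
  have card: "n = 2 ^ e" if "int n = 2 ^ k * m ^ 3" for n
  proof -
    have "int n = int (2 ^ e)"
      using that by (simp add: e(1) m(2) power_add)
    then show ?thesis by (rule injD[OF inj_of_nat])
  qed
  consider "k = 0" | "k = 1" | "k = 2"
    using e(2) by linarith
  then show ?thesis
  proof cases
    case 1
    \<comment> \<open>For \<open>k = 0\<close>, the bound \<open>e \<ge> 1\<close> excludes
      \<open>m = 1\<close>, where the lattice would contain the unit vector.\<close>
    then have "j > 0"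
      using assms e(1) by simp
    then have "m > 1"
      by (simp add: m_def)
    show ?thesis
      by (rule exI, rule exI, intro conjI, rule primitive_lattice(1)[OF \<open>m > 1\<close>], rule primitive_lattice(2)[OF \<open>m > 1\<close>], rule card)
        (simp add: primitive_lattice(3)[OF \<open>m > 1\<close>] 1)
  next
    case 2
    show ?thesis
      by (rule exI, rule exI, intro conjI, rule face_centred_lattice(1)[OF m(1)], rule face_centred_lattice(2)[OF m(1)], rule card)
        (simp add: face_centred_lattice(3)[OF m(1)] 2)
  next
    case 3
    show ?thesis
      by (rule exI, rule exI, intro conjI, rule body_centred_lattice(1)[OF m(1)], rule body_centred_lattice(2)[OF m(1)], rule card)
        (simp add: body_centred_lattice(3)[OF m(1)] 3)
  qed
qed


theorem corollary5p2:
  fixes n :: nat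
  assumes "n \<ge> 5"
  shows "\<exists>(G :: nat monoid) \<rho>. string_C_group3 G \<rho> \<and>
    order G = 3 * 2 ^ n \<and> schlafli_type G \<rho> = (6, 6)"
proof -
  \<comment> \<open>Since \<open>3 * 2 ^ n = 48 * 2 ^ (n - 4)\<close>, the required index is
    \<open>2 ^ (n - 4)\<close>, and \<open>n \<ge> 5\<close> makes it nontrivial.\<close>
  have "n - 4 \<ge> 1"
    using assms by simp
  from invariant_lattice_exists[OF this] obtain L and r :: "vec \<Rightarrow> int \<times> int \<times> int" where r: "invariant_lattice L r"
    "finite (range r)" "card (range r) = 2 ^ (n - 4)"
    by blast
  have "(2 :: nat) ^ n = 2 ^ 4 * 2 ^ (n - 4)"
    using assms by (subst power_add[symmetric]) simp
  then have "48 * card (range r) = 3 * 2 ^ n"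
    by (simp add: r(3))
  then show ?thesis
    using invariant_lattice.string_C_quotient[OF r(1,2)] by metis
qed

end
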